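(* Let $r,b,d\ge 1$ be integers, consider the P\'olya urn started with $r$ red and $b$ black balls and with $d$ added balls per draw, let $Z_n$ be the proportion of red balls after the $n$th draw, and let $M_{r,b}=\sup_{n\ge 1} Z_n$. Define $$Q=\Big\{ \max_{1\le j\le n} \frac{r+i_jd}{r+b+jd}\ \Big| \ n\in \mathbf{N},\ i_1,\ldots,i_n\in \mathbf{N}\cup\{0\},\ i_j\le j \text{ for all } j\in\{1,\ldots,n\},\ 0\le i_1\le i_2\le\ldots\le i_n\Big\}.$$ Then $\mathbf{P}(M_{r,b}=q)>0$ for all $q\in Q$.
   Context: P\'olya's urn with integer parameters $r,b,d\ge 1$: the urn initially contains $r$ red and $b$ black balls. In each draw one ball is taken uniformly at random from the urn, and this ball together with another $d$ balls of the same color is put into the urn. $R_n$ is the number of red balls in the urn after the $n$th draw ($R_0=r$), and $Z_n=R_n/(nd+r+b)$. $\mathbf{N}=\{1,2,\ldots\}$. *)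

theory Defs
  imports "HOL-Probability.Probability"
begin

datatype colour = Red | Black

text \<open>Content of the urn after the \<open>n\<close>th draw, where \<open>c k\<close> is the colour of the ball taken in
  draw \<open>k \<ge> 1\<close>; the value \<open>c 0\<close> is never used.\<close>

primrec urn :: "nat \<Rightarrow> nat \<Rightarrow> nat \<Rightarrow> (nat \<Rightarrow> colour) \<Rightarrow> nat \<Rightarrow> colour multiset" where
  "urn r b d c 0 = replicate_mset r Red + replicate_mset b Black"
| "urn r b d c (Suc n) = urn r b d c n + replicate_mset d (c (Suc n))"

text \<open>\<open>C k \<omega>\<close> is the colour of the ball taken in draw \<open>k\<close>. Given the outcomes \<open>c\<close> of the
  first \<open>n\<close> draws, the next ball is uniformly distributed on the current urn, so that its colour
  has law \<^const>\<open>pmf_of_multiset\<close>.\<close>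

locale polya_urn = prob_space M for M :: "'a measure" +
  fixes r b d :: nat and C :: "nat \<Rightarrow> 'a \<Rightarrow> colour"
  assumes measurable_draw: "\<And>n. n \<ge> 1 \<Longrightarrow> C n \<in> M \<rightarrow>\<^sub>M count_space UNIV"
    and uniform_draw: "\<And>n c x. \<P>(\<omega> in M. \<forall>k\<in>{1..n}. C k \<omega> = c k) > 0 \<Longrightarrow>
          \<P>(\<omega> in M. C (Suc n) \<omega> = x \<bar> \<forall>k\<in>{1..n}. C k \<omega> = c k)
            = pmf (pmf_of_multiset (urn r b d c n)) x"

definition R :: "nat \<Rightarrow> nat \<Rightarrow> nat \<Rightarrow> (nat \<Rightarrow> 'a \<Rightarrow> colour) \<Rightarrow> nat \<Rightarrow> 'a \<Rightarrow> nat" where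
  "R r b d C n \<omega> = count (urn r b d (\<lambda>k. C k \<omega>) n) Red"

definition Z :: "nat \<Rightarrow> nat \<Rightarrow> nat \<Rightarrow> (nat \<Rightarrow> 'a \<Rightarrow> colour) \<Rightarrow> nat \<Rightarrow> 'a \<Rightarrow> real" where
  "Z r b d C n \<omega> = real (R r b d C n \<omega>) / real (n * d + r + b)"

text \<open>The set over which the supremum is taken is nonempty and bounded by 1, so the supremum in
  \<^typ>\<open>real\<close> is the genuine one.\<close>

definition maximal_proportion ::
    "nat \<Rightarrow> nat \<Rightarrow> nat \<Rightarrow> (nat \<Rightarrow> 'a \<Rightarrow> colour) \<Rightarrow> 'a \<Rightarrow> real" where
  "maximal_proportion r b d C \<omega> = (SUP n\<in>{1..}. Z r b d C n \<omega>)"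

definition Q :: "nat \<Rightarrow> nat \<Rightarrow> nat \<Rightarrow> real set" where
  "Q r b d =
    {Max ((\<lambda>j. real (r + i j * d) / real (r + b + j * d)) ` {1..n}) | (n::nat) (i::nat \<Rightarrow> nat).
      n \<ge> 1 \<and> (\<forall>j\<in>{1..n}. i j \<le> j) \<and> mono_on {1..n} i}"

end

theory Submission
  imports Defs
begin

text \<open>Every \<open>q \<in> Q\<close> has the form \<open>(r + i d) / (r + b + j d)\<close> with \<open>i \<le> j\<close> and \<open>j \<ge> 1\<close>, and
  \<open>q \<ge> r / (r + b + d)\<close> because the maximum defining \<open>q\<close> includes the first draw
  (\<open>Q_cases\<close>). These two facts suffice to find a path of the urn with maximum \<open>q\<close>.

  Draw \<open>j - i\<close> black balls and then \<open>i\<close> red ones. The proportion of red balls falls during the black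
  draws and rises during the red ones, so over these \<open>j\<close> draws it is largest after the first or after
  the last; by the lower bound on \<open>q\<close> it never exceeds \<open>q\<close>, and after draw \<open>j\<close> it equals \<open>q\<close>. One
  further black ball takes it strictly below \<open>q\<close> (\<open>proportion_black_then_red\<close>). Such a finite
  history has positive probability, because both colours are always present in the urn
  (\<open>prob_history_pos\<close>).

  It remains to see that from a proportion \<open>z < q\<close> the urn has a positive chance of never exceeding
  \<open>q\<close> again. The proportion is a nonnegative martingale, so by the maximal inequality of
  Ville and Doob it exceeds \<open>q\<close> at some later time with conditional probability at most \<open>z / q < 1\<close>
  (\<open>maximal_inequality\<close>). The draws are specified by their conditional laws given a finite history,
  so the inequality is proved directly by backward induction along histories, without filtrations or
  conditional expectations.\<close>

section \<open>Deterministic urn paths\<close>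

definition proportion :: "nat \<Rightarrow> nat \<Rightarrow> nat \<Rightarrow> (nat \<Rightarrow> colour) \<Rightarrow> nat \<Rightarrow> real" where
  "proportion r b d c n = real (count (urn r b d c n) Red) / real (n * d + r + b)"

lemma Z_eq_proportion: "Z r b d C n \<omega> = proportion r b d (\<lambda>k. C k \<omega>) n"
  by (simp add: Z_def R_def proportion_def)

lemma urn_cong: "(\<And>k. k \<in> {1..n} \<Longrightarrow> c k = c' k) \<Longrightarrow> urn r b d c n = urn r b d c' n"
  by (induction n) auto

lemma proportion_cong:
  "(\<And>k. k \<in> {1..n} \<Longrightarrow> c k = c' k) \<Longrightarrow> proportion r b d c n = proportion r b d c' n"
  unfolding proportion_def by (metis urn_cong)

lemma size_urn: "size (urn r b d c n) = n * d + r + b"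
  by (induction n) auto

text \<open>Fractions of the urn can be compared with 1 because there is no third colour.\<close>

lemma count_urn_Red_Black:
  "count (urn r b d c n) Red + count (urn r b d c n) Black = n * d + r + b"
proof (induction n)
  case (Suc n)
  then show ?case by (cases "c (Suc n)") auto
qed simp

lemma count_urn_pos:
  assumes "r \<ge> 1" "b \<ge> 1"
  shows "count (urn r b d c n) x > 0"
  using assms by (induction n) (cases x; auto)+

lemma pmf_urn:
  assumes "r \<ge> 1"
  shows "pmf (pmf_of_multiset (urn r b d c n)) x = count (urn r b d c n) x / real (n * d + r + b)"
proof -
  have "urn r b d c n \<noteq> {#}"
    using assms size_urn[of r b d c n] by auto
  then show ?thesis
    by (simp add: size_urn)
qed

lemma proportion_le_1: "proportion r b d c n \<le> 1"
proof -
  have "count (urn r b d c n) Red \<le> n * d + r + b"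
    using count_urn_Red_Black[of r b d c n] by linarith
  then show ?thesis
    unfolding proportion_def by (intro divide_le_eq_1[THEN iffD2]) (auto simp del: of_nat_add of_nat_mult)
qed

text \<open>The martingale property in one step: with \<open>u\<close> red and \<open>v\<close> black balls, the mean proportion
  after the next draw is \<open>(u (u + d) + v u) / ((u + v) (u + v + d)) = u / (u + v)\<close>.\<close>

lemma proportion_martingale:
  assumes "r \<ge> 1"
  shows "(\<Sum>x\<in>{Red, Black}. pmf (pmf_of_multiset (urn r b d c n)) x
            * proportion r b d (c(Suc n := x)) (Suc n)) = proportion r b d c n"
proof -
  have urn: "urn r b d (c(Suc n := x)) n = urn r b d c n" for x
    by (rule urn_cong) auto
  define u v where "u = real (count (urn r b d c n) Red)"
    and "v = real (count (urn r b d c n) Black)"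
  have uv: "u + v = real (n * d + r + b)"
    unfolding u_def v_def using count_urn_Red_Black[of r b d c n] by linarith
  have pos: "u + v > 0" unfolding uv using assms by (simp del: of_nat_add of_nat_mult)
  have uv': "real (Suc n * d + r + b) = u + v + real d"
    unfolding uv by simp
  have "u / (u + v) * ((u + d) / (u + v + d)) + v / (u + v) * (u / (u + v + d))
          = u * (u + v + d) / ((u + v) * (u + v + d))"
    by (simp add: add_divide_distrib[symmetric] algebra_simps)
  also have "\<dots> = u / (u + v)"
    using pos by simp
  finally have "u / (u + v) * ((u + d) / (u + v + d)) + v / (u + v) * (u / (u + v + d)) = u / (u + v)" .
  then show ?thesis
    using assms unfolding pmf_urn[OF assms] proportion_def uv' uv[symmetric]
    by (simp add: urn u_def[symmetric] v_def[symmetric])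
qed

section \<open>The random urn and its maximal inequality\<close>

context polya_urn
begin

lemma measurable_proportion [measurable]:
  "(\<lambda>\<omega>. proportion r b d (\<lambda>k. C k \<omega>) n) \<in> borel_measurable M"
proof -
  have "(\<lambda>\<omega>. real (count (urn r b d (\<lambda>k. C k \<omega>) n) Red)) \<in> borel_measurable M"
  proof (induction n)
    case (Suc n)
    have [measurable]: "C (Suc n) \<in> M \<rightarrow>\<^sub>M count_space UNIV"
      by (rule measurable_draw) simp
    have "(\<lambda>\<omega>. real (count (urn r b d (\<lambda>k. C k \<omega>) n) Red) + (if C (Suc n) \<omega> = Red then real d else 0))
            \<in> borel_measurable M"
      using Suc by measurable
    then show ?case
      by (rule measurable_cong[THEN iffD1, rotated]) auto
  qed simp
  then show ?thesis
    unfolding proportion_def by measurable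
qed

lemma measurable_history [measurable]: "Measurable.pred M (\<lambda>\<omega>. \<forall>k\<in>{1..n}. C k \<omega> = c k)"
proof (rule pred_intros_finite)
  fix k assume "k \<in> {1..n}"
  then have [measurable]: "C k \<in> M \<rightarrow>\<^sub>M count_space UNIV"
    by (intro measurable_draw) simp
  show "Measurable.pred M (\<lambda>\<omega>. C k \<omega> = c k)"
    by measurable
qed simp

text \<open>The chain rule for histories. It also covers histories of probability zero, for which the
  conditional law of the next draw is unspecified: there both sides vanish.\<close>

lemma prob_history_extend:
  "\<P>(\<omega> in M. \<forall>k\<in>{1..Suc n}. C k \<omega> = (c(Suc n := x)) k)
     = \<P>(\<omega> in M. \<forall>k\<in>{1..n}. C k \<omega> = c k) * pmf (pmf_of_multiset (urn r b d c n)) x"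
proof -
  have "(\<forall>k\<in>{1..Suc n}. C k \<omega> = (c(Suc n := x)) k)
          \<longleftrightarrow> C (Suc n) \<omega> = x \<and> (\<forall>k\<in>{1..n}. C k \<omega> = c k)" for \<omega>
    by (auto simp: atLeastAtMostSuc_conv)
  then have eq: "\<P>(\<omega> in M. \<forall>k\<in>{1..Suc n}. C k \<omega> = (c(Suc n := x)) k)
      = \<P>(\<omega> in M. C (Suc n) \<omega> = x \<and> (\<forall>k\<in>{1..n}. C k \<omega> = c k))"
    by simp
  show ?thesis
  proof (cases "\<P>(\<omega> in M. \<forall>k\<in>{1..n}. C k \<omega> = c k) > 0")
    case True
    from uniform_draw[OF True, of x] True show ?thesis
      unfolding eq cond_prob_def by (simp add: field_simps)
  next
    case False
    then have 0: "\<P>(\<omega> in M. \<forall>k\<in>{1..n}. C k \<omega> = c k) = 0"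
      by (simp add: zero_less_measure_iff)
    have "\<P>(\<omega> in M. C (Suc n) \<omega> = x \<and> (\<forall>k\<in>{1..n}. C k \<omega> = c k))
            \<le> \<P>(\<omega> in M. \<forall>k\<in>{1..n}. C k \<omega> = c k)"
      by (rule finite_measure_mono) (blast, measurable)
    then show ?thesis
      unfolding eq 0 by (simp add: measure_le_0_iff)
  qed
qed

lemma prob_history_pos:
  assumes "r \<ge> 1" "b \<ge> 1"
  shows "\<P>(\<omega> in M. \<forall>k\<in>{1..n}. C k \<omega> = c k) > 0"
proof (induction n)
  case 0
  then show ?case by (simp add: prob_space)
next
  case (Suc n)
  have "pmf (pmf_of_multiset (urn r b d c n)) (c (Suc n)) > 0"
    using assms count_urn_pos[OF assms, of d c n] by (simp add: pmf_urn del: of_nat_add of_nat_mult)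
  with Suc prob_history_extend[of n c "c (Suc n)"] show ?case
    by simp
qed

text \<open>The maximal inequality up to a finite horizon, after a given history. If the proportion already
  exceeds \<open>q\<close>, the factor \<open>z / q\<close> is at least 1. Otherwise an excess can only happen from the next
  draw on; splitting by the colour of that draw, the bounds for the two extended histories average
  to the claimed bound by the martingale property. The induction is over the horizon \<open>N\<close>, for all
  histories simultaneously.\<close>

lemma maximal_inequality_finite:
  assumes "r \<ge> 1" "q > 0"
  shows "\<P>(\<omega> in M. (\<forall>k\<in>{1..m}. C k \<omega> = c k) \<and> (\<exists>n\<in>{m..m+N}. proportion r b d (\<lambda>k. C k \<omega>) n > q))
           \<le> \<P>(\<omega> in M. \<forall>k\<in>{1..m}. C k \<omega> = c k) * (proportion r b d c m / q)"
    (is "?bad m c N \<le> ?hist m c * _")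
proof (induction N arbitrary: m c)
  case IH: (Suc N)
  show ?case
  proof (cases "proportion r b d c m > q")
    case True
    have "?bad m c (Suc N) \<le> ?hist m c"
      by (rule finite_measure_mono) (blast, measurable)
    also have "\<dots> \<le> ?hist m c * (proportion r b d c m / q)"
      using True assms mult_left_mono[of 1 "proportion r b d c m / q" "?hist m c"] by simp
    finally show ?thesis .
  next
    case False
    have split: "{\<omega>\<in>space M. (\<forall>k\<in>{1..m}. C k \<omega> = c k) \<and> (\<exists>n\<in>{m..m+Suc N}. proportion r b d (\<lambda>k. C k \<omega>) n > q)}
      \<subseteq> (\<Union>x\<in>{Red,Black}. {\<omega>\<in>space M. (\<forall>k\<in>{1..Suc m}. C k \<omega> = (c(Suc m := x)) k)
            \<and> (\<exists>n\<in>{Suc m..Suc m+N}. proportion r b d (\<lambda>k. C k \<omega>) n > q)})" (is "_ \<subseteq> (\<Union>x\<in>_. ?E x)")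
    proof
      fix \<omega> assume "\<omega> \<in> {\<omega>\<in>space M. (\<forall>k\<in>{1..m}. C k \<omega> = c k) \<and> (\<exists>n\<in>{m..m+Suc N}. proportion r b d (\<lambda>k. C k \<omega>) n > q)}"
      then obtain n where \<omega>: "\<omega> \<in> space M" and hist: "\<forall>k\<in>{1..m}. C k \<omega> = c k"
        and n: "n \<in> {m..m+Suc N}" "proportion r b d (\<lambda>k. C k \<omega>) n > q"
        by blast
      have "proportion r b d (\<lambda>k. C k \<omega>) m = proportion r b d c m"
        using hist by (intro proportion_cong) simp
      with n False have "n \<noteq> m" by auto
      with n have "n \<in> {Suc m..Suc m+N}" by auto
      moreover have "\<forall>k\<in>{1..Suc m}. C k \<omega> = (c(Suc m := C (Suc m) \<omega>)) k"
        using hist by (auto simp: le_Suc_eq)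
      ultimately have "\<omega> \<in> ?E (C (Suc m) \<omega>)"
        using \<omega> n by blast
      moreover have "C (Suc m) \<omega> \<in> {Red, Black}"
        by (cases "C (Suc m) \<omega>") auto
      ultimately show "\<omega> \<in> (\<Union>x\<in>{Red,Black}. ?E x)" by blast
    qed
    have meas: "?E x \<in> sets M" for x
      by measurable
    have "?bad m c (Suc N) \<le> measure M (\<Union>x\<in>{Red,Black}. ?E x)"
      using split by (rule finite_measure_mono) (intro sets.finite_UN meas finite.intros)
    also have "\<dots> \<le> (\<Sum>x\<in>{Red,Black}. measure M (?E x))"
      by (intro finite_measure_subadditive_finite image_subsetI meas finite.intros)
    also have "\<dots> \<le> (\<Sum>x\<in>{Red,Black}. ?hist (Suc m) (c(Suc m := x))
                        * (proportion r b d (c(Suc m := x)) (Suc m) / q))"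
      by (rule sum_mono) (rule IH)
    also have "\<dots> = (\<Sum>x\<in>{Red,Black}. ?hist m c / q * (pmf (pmf_of_multiset (urn r b d c m)) x
                        * proportion r b d (c(Suc m := x)) (Suc m)))"
      unfolding prob_history_extend by (simp add: mult_ac)
    also have "\<dots> = ?hist m c / q * proportion r b d c m"
      unfolding sum_distrib_left[symmetric] proportion_martingale[OF assms(1)] ..
    finally show ?thesis by simp
  qed
next
  case (0 m c)
  have *: "proportion r b d (\<lambda>k. C k \<omega>) m = proportion r b d c m" if "\<forall>k\<in>{1..m}. C k \<omega> = c k" for \<omega>
    using that by (intro proportion_cong) simp
  show ?case
  proof (cases "proportion r b d c m > q")
    case True
    have "?bad m c 0 \<le> ?hist m c"
      by (rule finite_measure_mono) (blast, measurable)
    also have "\<dots> \<le> ?hist m c * (proportion r b d c m / q)"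
      using True assms mult_left_mono[of 1 "proportion r b d c m / q" "?hist m c"] by simp
    finally show ?thesis .
  next
    case False
    with * have none: "{\<omega>\<in>space M. (\<forall>k\<in>{1..m}. C k \<omega> = c k) \<and> (\<exists>n\<in>{m..m+0}. proportion r b d (\<lambda>k. C k \<omega>) n > q)} = {}"
      by auto
    have "proportion r b d c m \<ge> 0" by (simp add: proportion_def)
    then show ?thesis
      unfolding none using assms by simp
  qed
qed

text \<open>The bound does not depend on the horizon, so it survives the passage to infinite horizon by
  continuity of the measure along increasing events.\<close>

lemma maximal_inequality:
  assumes "r \<ge> 1" "q > 0"
  shows "\<P>(\<omega> in M. (\<forall>k\<in>{1..m}. C k \<omega> = c k) \<and> (\<exists>n\<ge>m. proportion r b d (\<lambda>k. C k \<omega>) n > q))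
           \<le> \<P>(\<omega> in M. \<forall>k\<in>{1..m}. C k \<omega> = c k) * (proportion r b d c m / q)"
proof -
  let ?A = "\<lambda>N. {\<omega>\<in>space M. (\<forall>k\<in>{1..m}. C k \<omega> = c k)
                   \<and> (\<exists>n\<in>{m..m+N}. proportion r b d (\<lambda>k. C k \<omega>) n > q)}"
  have "(\<lambda>N. measure M (?A N)) \<longlonglongrightarrow> measure M (\<Union>N. ?A N)"
  proof (rule finite_Lim_measure_incseq)
    show "range ?A \<subseteq> sets M"
      by (intro image_subsetI) measurable
    show "incseq ?A"
      by (intro monoI) fastforce
  qed
  moreover have "(\<Union>N. ?A N) = {\<omega>\<in>space M. (\<forall>k\<in>{1..m}. C k \<omega> = c k)
                   \<and> (\<exists>n\<ge>m. proportion r b d (\<lambda>k. C k \<omega>) n > q)}"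
    by (auto simp: Bex_def) (metis le_add_diff_inverse order_refl)
  ultimately show ?thesis
    using maximal_inequality_finite[OF assms, of m c]
    by (auto intro!: LIMSEQ_le_const2)
qed

lemma prob_stays_below_pos:
  assumes "r \<ge> 1" "b \<ge> 1" "proportion r b d c m < q"
  shows "\<P>(\<omega> in M. (\<forall>k\<in>{1..m}. C k \<omega> = c k) \<and> (\<forall>n\<ge>m. proportion r b d (\<lambda>k. C k \<omega>) n \<le> q)) > 0"
proof -
  let ?H = "{\<omega>\<in>space M. \<forall>k\<in>{1..m}. C k \<omega> = c k}"
  let ?B = "{\<omega>\<in>space M. (\<forall>k\<in>{1..m}. C k \<omega> = c k) \<and> (\<exists>n\<ge>m. proportion r b d (\<lambda>k. C k \<omega>) n > q)}"
  have "proportion r b d c m \<ge> 0" by (simp add: proportion_def)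
  with assms have q: "q > 0" by linarith
  have "measure M ?B \<le> measure M ?H * (proportion r b d c m / q)"
    by (rule maximal_inequality[OF assms(1) q])
  also have "\<dots> < measure M ?H"
    using prob_history_pos[OF assms(1,2), of m c] assms(3) q by (simp add: field_simps)
  finally have "0 < measure M ?H - measure M ?B" by simp
  also have "\<dots> = measure M (?H - ?B)"
    by (rule finite_measure_Diff[symmetric]) (measurable, blast)
  also have "?H - ?B = {\<omega>\<in>space M. (\<forall>k\<in>{1..m}. C k \<omega> = c k)
                          \<and> (\<forall>n\<ge>m. proportion r b d (\<lambda>k. C k \<omega>) n \<le> q)}"
    by (auto simp: not_less)
  finally show ?thesis .
qed

text \<open>Without measurability, the measure of the event \<open>maximal_proportion r b d C \<omega> = q\<close> would be
  the default value 0.\<close>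

lemma measurable_maximal_proportion [measurable]:
  "maximal_proportion r b d C \<in> borel_measurable M"
  unfolding maximal_proportion_def[abs_def] Z_eq_proportion
proof (rule borel_measurable_cSUP)
  show "bdd_above ((\<lambda>n. proportion r b d (\<lambda>k. C k \<omega>) n) ` {1..})" for \<omega>
    by (rule bdd_aboveI2[of _ _ 1]) (rule proportion_le_1)
qed auto

text \<open>A record of a finite path becomes the overall maximum with positive probability if the next step
  of the path goes strictly down: strictness is what makes \<open>z / q < 1\<close> in the maximal
  inequality.\<close>

lemma prob_maximal_proportion_pos:
  assumes "r \<ge> 1" "b \<ge> 1" "1 \<le> j"
    and below: "\<And>n. n \<in> {1..j} \<Longrightarrow> proportion r b d c n \<le> proportion r b d c j"
    and drop: "proportion r b d c (Suc j) < proportion r b d c j"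
  shows "\<P>(\<omega> in M. maximal_proportion r b d C \<omega> = proportion r b d c j) > 0"
proof -
  let ?q = "proportion r b d c j"
  let ?G = "{\<omega>\<in>space M. (\<forall>k\<in>{1..Suc j}. C k \<omega> = c k)
               \<and> (\<forall>n\<ge>Suc j. proportion r b d (\<lambda>k. C k \<omega>) n \<le> ?q)}"
  have "0 < measure M ?G"
    by (rule prob_stays_below_pos[OF assms(1,2) drop])
  also have "\<dots> \<le> measure M {\<omega>\<in>space M. maximal_proportion r b d C \<omega> = ?q}"
  proof (rule finite_measure_mono)
    show "?G \<subseteq> {\<omega>\<in>space M. maximal_proportion r b d C \<omega> = ?q}"
    proof safe
      fix \<omega> assume hist: "\<forall>k\<in>{1..Suc j}. C k \<omega> = c k"
        and future: "\<forall>n\<ge>Suc j. proportion r b d (\<lambda>k. C k \<omega>) n \<le> ?q"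
      have past: "proportion r b d (\<lambda>k. C k \<omega>) n = proportion r b d c n" if "n \<le> j" for n
        using hist that by (intro proportion_cong) simp
      show "maximal_proportion r b d C \<omega> = ?q"
        unfolding maximal_proportion_def Z_eq_proportion
      proof (rule cSup_eq_maximum)
        show "?q \<in> (\<lambda>n. proportion r b d (\<lambda>k. C k \<omega>) n) ` {1..}"
          using past[of j] assms(3) by (intro image_eqI[of _ _ j]) auto
      next
        fix x assume "x \<in> (\<lambda>n. proportion r b d (\<lambda>k. C k \<omega>) n) ` {1..}"
        then obtain n where n: "n \<ge> 1" "x = proportion r b d (\<lambda>k. C k \<omega>) n" by auto
        show "x \<le> ?q"
        proof (cases "n \<le> j")
          case True
          then show ?thesis using n past[of n] below[of n] by simp
        next
          case False
          then show ?thesis using n future by simp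
        qed
      qed
    qed
  qed measurable
  finally show ?thesis .
qed

end

section \<open>A path with a prescribed maximum\<close>

text \<open>The sequence \<open>i\<^sub>1, \<dots>, i\<^sub>n\<close> in the definition of \<open>Q\<close> may jump by more than 1 and then is
  not the red count of any urn path. So the path realising \<open>q\<close> is not read off from it; what is kept
  is the index where the maximum is attained, together with the bound from \<open>j = 1\<close>.\<close>

lemma Q_cases:
  assumes "q \<in> Q r b d"
  obtains i j where "1 \<le> j" "i \<le> j" "q = real (r + i * d) / real (r + b + j * d)"
    "real r / real (r + b + d) \<le> q"
proof -
  from assms obtain n and i :: "nat \<Rightarrow> nat" where n: "n \<ge> 1" and i: "\<forall>j\<in>{1..n}. i j \<le> j"
    and q: "q = Max ((\<lambda>j. real (r + i j * d) / real (r + b + j * d)) ` {1..n})"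
    unfolding Q_def by blast
  have "q \<in> (\<lambda>j. real (r + i j * d) / real (r + b + j * d)) ` {1..n}"
    unfolding q using n by (intro Max_in) auto
  then obtain j where j: "j \<in> {1..n}" "q = real (r + i j * d) / real (r + b + j * d)" by auto
  have "real r / real (r + b + d) \<le> real (r + i 1 * d) / real (r + b + 1 * d)"
    by (simp add: divide_right_mono)
  also have "\<dots> \<le> q"
    unfolding q using n by (intro Max_ge imageI) auto
  finally show thesis
    using that[of j "i j"] i j by auto
qed

text \<open>Draws after the \<open>j\<close>th are black, so that the proportion falls right after its last
  peak.\<close>

definition black_then_red :: "nat \<Rightarrow> nat \<Rightarrow> nat \<Rightarrow> colour" where
  "black_then_red i j k = (if j - i < k \<and> k \<le> j then Red else Black)"

text \<open>The truncated subtraction gives 0 red draws as long as only black balls have been taken.\<close>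

lemma count_black_then_red:
  assumes "i \<le> j"
  shows "count (urn r b d (black_then_red i j) n) Red = r + (min n j - (j - i)) * d"
proof (induction n)
  case (Suc n)
  consider "Suc n \<le> j - i" | "j - i < Suc n" "Suc n \<le> j" | "j < Suc n" by linarith
  then show ?case
  proof cases
    case 2
    then have "min (Suc n) j - (j - i) = Suc (min n j - (j - i))" using assms by auto
    with 2 Suc show ?thesis by (simp add: black_then_red_def)
  qed (use Suc assms in \<open>auto simp: black_then_red_def min_def not_le\<close>)
qed (use assms in simp)

text \<open>In the black phase the proportion is at most its value \<open>r / (r + b + d)\<close> after the first draw,
  which the hypothesis bounds. In the red phase, adding the same amount to the numerator and the
  denominator of a fraction not exceeding 1 does not decrease it.\<close>

lemma proportion_black_then_red:
  assumes "r \<ge> 1" "d \<ge> 1" "1 \<le> j" "i \<le> j"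
    and first: "real r / real (r + b + d) \<le> real (r + i * d) / real (r + b + j * d)"
  shows "proportion r b d (black_then_red i j) j = real (r + i * d) / real (r + b + j * d)" (is "?at")
    and "proportion r b d (black_then_red i j) (Suc j) < proportion r b d (black_then_red i j) j" (is "?drop")
    and "n \<in> {1..j} \<Longrightarrow> proportion r b d (black_then_red i j) n
          \<le> proportion r b d (black_then_red i j) j" (is "_ \<Longrightarrow> ?below")
proof -
  show ?at
    unfolding proportion_def count_black_then_red[OF assms(4)] using assms by (simp add: add_ac)
  show ?drop
    unfolding proportion_def count_black_then_red[OF assms(4)] using assms
    by (auto intro!: divide_strict_left_mono simp del: of_nat_add of_nat_mult)
  assume n: "n \<in> {1..j}"
  show ?below
  proof (cases "n \<le> j - i")
    case True
    then have "proportion r b d (black_then_red i j) n = real r / real (n * d + r + b)"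
      unfolding proportion_def count_black_then_red[OF assms(4)] by simp
    also have "\<dots> \<le> real r / real (r + b + d)"
    proof (rule divide_left_mono)
      have "1 * d \<le> n * d" using n by (intro mult_right_mono) auto
      then show "real (r + b + d) \<le> real (n * d + r + b)" by linarith
    qed (use assms in \<open>auto simp del: of_nat_add of_nat_mult\<close>)
    also have "\<dots> \<le> proportion r b d (black_then_red i j) j"
      unfolding \<open>?at\<close> by (rule first)
    finally show ?thesis .
  next
    case False
    \<comment> \<open>\<open>k\<close> red balls have been taken by time \<open>n\<close>, and the \<open>t\<close> draws up to time \<open>j\<close> are red.\<close>
    define k where "k = n - (j - i)"
    define t where "t = j - n"
    have i: "i = k + t" and j: "j = n + t"
      using False n assms(4) by (auto simp: k_def t_def)
    have kn: "k \<le> n" using k_def by simp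
    have "proportion r b d (black_then_red i j) n = real (r + k * d) / real (r + b + n * d)"
      unfolding proportion_def count_black_then_red[OF assms(4)] using n by (simp add: k_def add_ac)
    also have "\<dots> \<le> (real (r + k * d) + real (t * d)) / (real (r + b + n * d) + real (t * d))"
    proof -
      have le: "x / y \<le> (x + s) / (y + s)" if "0 < y" "x \<le> y" "0 \<le> s" for x y s :: real
      proof -
        have "x * s \<le> y * s" using that by (intro mult_right_mono)
        then show ?thesis using that by (simp add: divide_simps algebra_simps)
      qed
      have "k * d \<le> n * d" using kn by simp
      then have "real (r + k * d) \<le> real (r + b + n * d)" by linarith
      then show ?thesis
        using assms(1) by (intro le) (auto simp del: of_nat_add of_nat_mult)
    qed
    also have "\<dots> = proportion r b d (black_then_red i j) j"
      unfolding \<open>?at\<close> by (simp add: i j algebra_simps)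
    finally show ?thesis .
  qed
qed

theorem proposition3p4:
  fixes M :: "'a measure" and r b d :: nat and C :: "nat \<Rightarrow> 'a \<Rightarrow> colour"
  assumes "r \<ge> 1" and "b \<ge> 1" and "d \<ge> 1"
    and "polya_urn M r b d C"
  shows "\<forall>q\<in>Q r b d. \<P>(\<omega> in M. maximal_proportion r b d C \<omega> = q) > 0"
proof
  interpret polya_urn M r b d C by fact
  fix q assume "q \<in> Q r b d"
  then obtain i j where ij: "1 \<le> j" "i \<le> j" and q: "q = real (r + i * d) / real (r + b + j * d)"
    and first: "real r / real (r + b + d) \<le> q"
    by (rule Q_cases)
  note path = proportion_black_then_red[OF assms(1,3) ij first[unfolded q]]
  show "\<P>(\<omega> in M. maximal_proportion r b d C \<omega> = q) > 0"
    using prob_maximal_proportion_pos[OF assms(1,2) ij(1) path(3) path(2)]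
    unfolding path(1) q[symmetric] .
qed

end
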